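(* Let $\mathscr{A}$ be a $C^*$-algebra. The following are equivalent. (i) There exists a conjugate-linear, multiplicative, $*$-preserving bijection $\rho:\mathscr{A}\to\mathscr{A}$ (no involutivity of $\rho$ is assumed). (ii) $\mathscr{A}$ is linearly $*$-isomorphic to its opposite $C^*$-algebra $\mathscr{A}^{\mathrm{op}}$. (iii) $\mathscr{A}$ is linearly $*$-isomorphic to its conjugate $C^*$-algebra $\overline{\mathscr{A}}$.
   Context: $C^*$-algebras are complex. $\mathscr{A}^{\mathrm{op}}$ is $\mathscr{A}$ with the same vector space structure, norm and involution but with the reversed product $a^{\mathrm{op}}b^{\mathrm{op}}=(ba)^{\mathrm{op}}$. $\overline{\mathscr{A}}$ is $\mathscr{A}$ with the same addition, product, norm and involution but with the conjugate scalar multiplication $\lambda\overline{a}=\overline{\bar\lambda a}$. *)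

theory Defs
  imports Complex_Main
begin

text \<open>
  A complex C*-algebra, not necessarily unital. The library classes supply the real
  normed algebra and the completeness; \<open>scaleC\<close> extends the real scalar
  multiplication to the complex numbers.
\<close>

class cstar_algebra = real_normed_algebra + banach +
  fixes scaleC :: "complex \<Rightarrow> 'a \<Rightarrow> 'a" (infixr "*\<^sub>C" 75)
    and star :: "'a \<Rightarrow> 'a"
  assumes scaleC_add_right: "c *\<^sub>C (x + y) = c *\<^sub>C x + c *\<^sub>C y"
    and scaleC_add_left: "(c + d) *\<^sub>C x = c *\<^sub>C x + d *\<^sub>C x"
    and scaleC_scaleC: "c *\<^sub>C d *\<^sub>C x = (c * d) *\<^sub>C x"
    and scaleR_scaleC: "r *\<^sub>R x = complex_of_real r *\<^sub>C x"
    and mult_scaleC_left: "c *\<^sub>C x * y = c *\<^sub>C (x * y)"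
    and mult_scaleC_right: "x * c *\<^sub>C y = c *\<^sub>C (x * y)"
    and norm_scaleC: "norm (c *\<^sub>C x) = cmod c * norm x"
    and star_add: "star (x + y) = star x + star y"
    and star_scaleC: "star (c *\<^sub>C x) = cnj c *\<^sub>C star x"
    and star_mult: "star (x * y) = star y * star x"
    and star_star: "star (star x) = x"
    and cstar_identity: "norm (star x * x) = (norm x)\<^sup>2"

lemma scaleC_one: "1 *\<^sub>C x = (x :: 'a :: cstar_algebra)"
  using scaleR_scaleC[of 1 x] by simp

lemma vector_space_scaleC:
  "vector_space (scaleC :: complex \<Rightarrow> 'a :: cstar_algebra \<Rightarrow> 'a)"
  by unfold_locales
    (simp_all add: scaleC_add_right scaleC_add_left scaleC_scaleC scaleC_one)

lemma norm_star: "norm (star x) = norm (x :: 'a :: cstar_algebra)"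
proof -
  have le: "norm y \<le> norm (star y)" for y :: 'a
  proof (cases "y = 0")
    case False
    have "norm y * norm y \<le> norm (star y) * norm y"
      using norm_mult_ineq[of "star y" y] by (simp add: cstar_identity power2_eq_square)
    then show ?thesis using False by simp
  qed simp
  show ?thesis using le[of x] le[of "star x"] by (simp add: star_star)
qed

datatype 'a opposite = Opp (unopp: 'a)

instantiation opposite :: (cstar_algebra) real_normed_algebra
begin

definition "0 = Opp 0"
definition "x + y = Opp (unopp x + unopp y)"
definition "x - y = Opp (unopp x - unopp y)"
definition "- x = Opp (- unopp x)"
definition "x * y = Opp (unopp y * unopp x)"
definition "r *\<^sub>R x = Opp (r *\<^sub>R unopp x)"
definition "norm x = norm (unopp x)"
definition "sgn x = Opp (sgn (unopp x))"
definition "dist x y = dist (unopp x) (unopp y)"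
definition "uniformity = (INF e\<in>{0<..}. principal {(x :: 'a opposite, y). dist x y < e})"
definition "open (S :: 'a opposite set) =
  (\<forall>x\<in>S. eventually (\<lambda>(x', y). x' = x \<longrightarrow> y \<in> S) uniformity)"

lemmas opposite_ops =
  zero_opposite_def plus_opposite_def minus_opposite_def uminus_opposite_def times_opposite_def
  scaleR_opposite_def norm_opposite_def sgn_opposite_def dist_opposite_def

instance
proof
  fix x y z :: "'a opposite" and r s :: real
  show "x + y + z = x + (y + z)" "x + y = y + x" "0 + x = x" "- x + x = 0" "x - y = x + - y"
    by (simp_all add: opposite_ops)
  show "x * y * z = x * (y * z)" "(x + y) * z = x * z + y * z" "x * (y + z) = x * y + x * z"
    by (simp_all add: opposite_ops mult.assoc distrib_left distrib_right)
  show "r *\<^sub>R (x + y) = r *\<^sub>R x + r *\<^sub>R y" "(r + s) *\<^sub>R x = r *\<^sub>R x + s *\<^sub>R x"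
    "r *\<^sub>R s *\<^sub>R x = (r * s) *\<^sub>R x" "1 *\<^sub>R x = x"
    "r *\<^sub>R x * y = r *\<^sub>R (x * y)" "x * r *\<^sub>R y = r *\<^sub>R (x * y)"
    by (simp_all add: opposite_ops scaleR_add_right scaleR_add_left)
  show "sgn x = inverse (norm x) *\<^sub>R x" by (simp add: opposite_ops sgn_div_norm)
  show "dist x y = norm (x - y)" by (simp add: opposite_ops dist_norm)
  show "uniformity = (INF e\<in>{0<..}. principal {(x :: 'a opposite, y). dist x y < e})"
    by (rule uniformity_opposite_def)
  show "open S = (\<forall>x\<in>S. eventually (\<lambda>(x', y). x' = x \<longrightarrow> y \<in> S) uniformity)"
    for S :: "'a opposite set" by (rule open_opposite_def)
  show "norm x = 0 \<longleftrightarrow> x = 0" by (cases x) (simp add: opposite_ops)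
  show "norm (x + y) \<le> norm x + norm y" by (simp add: opposite_ops norm_triangle_ineq)
  show "norm (r *\<^sub>R x) = \<bar>r\<bar> * norm x" by (simp add: opposite_ops)
  show "norm (x * y) \<le> norm x * norm y"
    by (simp add: opposite_ops norm_mult_ineq mult.commute[of "norm (unopp x)"])
qed

end

instance opposite :: (cstar_algebra) banach
proof
  fix X :: "nat \<Rightarrow> 'a opposite"
  assume "Cauchy X"
  then have "Cauchy (\<lambda>n. unopp (X n))" by (simp add: Cauchy_def dist_opposite_def)
  then obtain l where "(\<lambda>n. unopp (X n)) \<longlonglongrightarrow> l"
    using Cauchy_convergent convergent_def by blast
  then have "X \<longlonglongrightarrow> Opp l" by (simp add: tendsto_iff dist_opposite_def)
  then show "convergent X" by (rule convergentI)
qed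

instantiation opposite :: (cstar_algebra) cstar_algebra
begin

definition "c *\<^sub>C x = Opp (c *\<^sub>C unopp x)"
definition "star x = Opp (star (unopp x))"

instance
proof
  fix x y :: "'a opposite" and r :: real and c d :: complex
  note ops = opposite_ops scaleC_opposite_def star_opposite_def
  show "c *\<^sub>C (x + y) = c *\<^sub>C x + c *\<^sub>C y" "(c + d) *\<^sub>C x = c *\<^sub>C x + d *\<^sub>C x"
    "c *\<^sub>C d *\<^sub>C x = (c * d) *\<^sub>C x" "r *\<^sub>R x = complex_of_real r *\<^sub>C x"
    "c *\<^sub>C x * y = c *\<^sub>C (x * y)" "x * c *\<^sub>C y = c *\<^sub>C (x * y)"
    "norm (c *\<^sub>C x) = cmod c * norm x"
    by (simp_all add: ops scaleC_add_right scaleC_add_left scaleC_scaleC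
        scaleR_scaleC mult_scaleC_left mult_scaleC_right norm_scaleC)
  show "star (x + y) = star x + star y" "star (c *\<^sub>C x) = cnj c *\<^sub>C star x"
    "star (x * y) = star y * star x" "star (star x) = x"
    by (simp_all add: ops star_add star_scaleC star_mult star_star)
  show "norm (star x * x) = (norm x)\<^sup>2"
    using cstar_identity[of "star (unopp x)"] by (simp add: ops star_star norm_star)
qed

end

datatype 'a conjugate = Conj (unconj: 'a)

instantiation conjugate :: (cstar_algebra) real_normed_algebra
begin

definition "0 = Conj 0"
definition "x + y = Conj (unconj x + unconj y)"
definition "x - y = Conj (unconj x - unconj y)"
definition "- x = Conj (- unconj x)"
definition "x * y = Conj (unconj x * unconj y)"
definition "r *\<^sub>R x = Conj (r *\<^sub>R unconj x)"
definition "norm x = norm (unconj x)"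
definition "sgn x = Conj (sgn (unconj x))"
definition "dist x y = dist (unconj x) (unconj y)"
definition "uniformity = (INF e\<in>{0<..}. principal {(x :: 'a conjugate, y). dist x y < e})"
definition "open (S :: 'a conjugate set) =
  (\<forall>x\<in>S. eventually (\<lambda>(x', y). x' = x \<longrightarrow> y \<in> S) uniformity)"

lemmas conjugate_ops =
  zero_conjugate_def plus_conjugate_def minus_conjugate_def uminus_conjugate_def times_conjugate_def
  scaleR_conjugate_def norm_conjugate_def sgn_conjugate_def dist_conjugate_def

instance
proof
  fix x y z :: "'a conjugate" and r s :: real
  show "x + y + z = x + (y + z)" "x + y = y + x" "0 + x = x" "- x + x = 0" "x - y = x + - y"
    by (simp_all add: conjugate_ops)
  show "x * y * z = x * (y * z)" "(x + y) * z = x * z + y * z" "x * (y + z) = x * y + x * z"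
    by (simp_all add: conjugate_ops mult.assoc distrib_left distrib_right)
  show "r *\<^sub>R (x + y) = r *\<^sub>R x + r *\<^sub>R y" "(r + s) *\<^sub>R x = r *\<^sub>R x + s *\<^sub>R x"
    "r *\<^sub>R s *\<^sub>R x = (r * s) *\<^sub>R x" "1 *\<^sub>R x = x"
    "r *\<^sub>R x * y = r *\<^sub>R (x * y)" "x * r *\<^sub>R y = r *\<^sub>R (x * y)"
    by (simp_all add: conjugate_ops scaleR_add_right scaleR_add_left)
  show "sgn x = inverse (norm x) *\<^sub>R x" by (simp add: conjugate_ops sgn_div_norm)
  show "dist x y = norm (x - y)" by (simp add: conjugate_ops dist_norm)
  show "uniformity = (INF e\<in>{0<..}. principal {(x :: 'a conjugate, y). dist x y < e})"
    by (rule uniformity_conjugate_def)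
  show "open S = (\<forall>x\<in>S. eventually (\<lambda>(x', y). x' = x \<longrightarrow> y \<in> S) uniformity)"
    for S :: "'a conjugate set" by (rule open_conjugate_def)
  show "norm x = 0 \<longleftrightarrow> x = 0" by (cases x) (simp add: conjugate_ops)
  show "norm (x + y) \<le> norm x + norm y" by (simp add: conjugate_ops norm_triangle_ineq)
  show "norm (r *\<^sub>R x) = \<bar>r\<bar> * norm x" by (simp add: conjugate_ops)
  show "norm (x * y) \<le> norm x * norm y"
    by (simp add: conjugate_ops norm_mult_ineq)
qed

end

instance conjugate :: (cstar_algebra) banach
proof
  fix X :: "nat \<Rightarrow> 'a conjugate"
  assume "Cauchy X"
  then have "Cauchy (\<lambda>n. unconj (X n))" by (simp add: Cauchy_def dist_conjugate_def)
  then obtain l where "(\<lambda>n. unconj (X n)) \<longlonglongrightarrow> l"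
    using Cauchy_convergent convergent_def by blast
  then have "X \<longlonglongrightarrow> Conj l" by (simp add: tendsto_iff dist_conjugate_def)
  then show "convergent X" by (rule convergentI)
qed

instantiation conjugate :: (cstar_algebra) cstar_algebra
begin

definition "c *\<^sub>C x = Conj (cnj c *\<^sub>C unconj x)"
definition "star x = Conj (star (unconj x))"

instance
proof
  fix x y :: "'a conjugate" and r :: real and c d :: complex
  note ops = conjugate_ops scaleC_conjugate_def star_conjugate_def
  show "c *\<^sub>C (x + y) = c *\<^sub>C x + c *\<^sub>C y" "(c + d) *\<^sub>C x = c *\<^sub>C x + d *\<^sub>C x"
    "c *\<^sub>C d *\<^sub>C x = (c * d) *\<^sub>C x" "r *\<^sub>R x = complex_of_real r *\<^sub>C x"
    "c *\<^sub>C x * y = c *\<^sub>C (x * y)" "x * c *\<^sub>C y = c *\<^sub>C (x * y)"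
    "norm (c *\<^sub>C x) = cmod c * norm x"
    by (simp_all add: ops scaleC_add_right scaleC_add_left scaleC_scaleC
        scaleR_scaleC mult_scaleC_left mult_scaleC_right norm_scaleC)
  show "star (x + y) = star x + star y" "star (c *\<^sub>C x) = cnj c *\<^sub>C star x"
    "star (x * y) = star y * star x" "star (star x) = x"
    by (simp_all add: ops star_add star_scaleC star_mult star_star)
  show "norm (star x * x) = (norm x)\<^sup>2"
    by (simp add: ops cstar_identity)
qed

end

text \<open>
  \<open>Vector_Spaces.linear scaleC scaleC\<close> is complex linearity; the unqualified
  \<open>linear\<close> of the library is linearity over the reals.
\<close>

definition star_isomorphism :: "('a :: cstar_algebra \<Rightarrow> 'b :: cstar_algebra) \<Rightarrow> bool" where
  "star_isomorphism f \<longleftrightarrow>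
    bij f \<and> Vector_Spaces.linear scaleC scaleC f \<and>
    (\<forall>x y. f (x * y) = f x * f y) \<and> (\<forall>x. f (star x) = star (f x))"

definition conjugate_linear :: "('a :: cstar_algebra \<Rightarrow> 'b :: cstar_algebra) \<Rightarrow> bool" where
  "conjugate_linear f \<longleftrightarrow>
    (\<forall>x y. f (x + y) = f x + f y) \<and> (\<forall>c x. f (c *\<^sub>C x) = cnj c *\<^sub>C f x)"

end

theory Submission
  imports Defs
begin

text \<open>
  The involution is a conjugate-linear, \<open>*\<close>-preserving anti-automorphism. Composing with it turns a
  conjugate-linear multiplicative map into a linear antimultiplicative one and vice versa, while a
  linear map into the conjugate algebra is literally a conjugate-linear map into the algebra itself.
\<close>

lemma star_eq_iff: "star x = star y \<longleftrightarrow> x = (y :: 'a :: cstar_algebra)"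
  by (metis star_star)

text \<open>Oriented against \<open>star_scaleC\<close>: as a rewrite rule it pulls
  \<open>star\<close> outward, so that \<open>star_eq_iff\<close> can cancel it from both sides of
  an equation.\<close>

lemma scaleC_star: "c *\<^sub>C star x = star (cnj c *\<^sub>C (x :: 'a :: cstar_algebra))"
  by (simp add: star_scaleC)

lemma bij_star: "bij (star :: 'a :: cstar_algebra \<Rightarrow> 'a)"
  by (rule o_bij[of star]) (simp_all add: fun_eq_iff star_star)

lemma bij_Opp: "bij Opp"
  by (rule o_bij[of unopp]) (simp_all add: fun_eq_iff)

lemma bij_Conj: "bij Conj"
  by (rule o_bij[of unconj]) (simp_all add: fun_eq_iff)

lemma bij_comp_left_iff: "bij g \<Longrightarrow> bij (\<lambda>x. g (f x)) \<longleftrightarrow> bij f"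
  using bij_betw_comp_iff2[of g UNIV UNIV f UNIV] by (simp add: comp_def bij_is_surj)

lemma star_isomorphism_iff:
  "star_isomorphism f \<longleftrightarrow> bij f \<and> (\<forall>x y. f (x + y) = f x + f y) \<and> (\<forall>c x. f (c *\<^sub>C x) = c *\<^sub>C f x) \<and>
    (\<forall>x y. f (x * y) = f x * f y) \<and> (\<forall>x. f (star x) = star (f x))"
  by (auto simp: star_isomorphism_def Vector_Spaces.linear_iff vector_space_scaleC)

text \<open>Each condition on the left becomes an equation between two values of
  \<open>star\<close>, and injectivity of \<open>star\<close> strips it off. The reversal of
  products by \<open>star\<close> undoes the reversal in the opposite algebra, while the scalar
  comes out conjugated.\<close>

lemma star_isomorphism_opposite_iff:
  fixes \<rho> :: "'a :: cstar_algebra \<Rightarrow> 'b :: cstar_algebra"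
  shows "star_isomorphism (\<lambda>x. Opp (star (\<rho> x))) \<longleftrightarrow>
    bij \<rho> \<and> conjugate_linear \<rho> \<and>
    (\<forall>x y. \<rho> (x * y) = \<rho> x * \<rho> y) \<and> (\<forall>x. \<rho> (star x) = star (\<rho> x))"
  by (simp add: star_isomorphism_iff conjugate_linear_def opposite_ops scaleC_opposite_def
      star_opposite_def bij_comp_left_iff[OF bij_Opp] bij_comp_left_iff[OF bij_star]
      scaleC_star star_add[symmetric] star_mult[symmetric] star_eq_iff)

text \<open>The \<open>cnj\<close> in the scalar multiplication of the conjugate algebra is the one
  in \<open>conjugate_linear\<close>; all other operations pass through \<open>Conj\<close>
  unchanged.\<close>

lemma star_isomorphism_conjugate_iff:
  fixes \<rho> :: "'a :: cstar_algebra \<Rightarrow> 'b :: cstar_algebra"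
  shows "star_isomorphism (\<lambda>x. Conj (\<rho> x)) \<longleftrightarrow>
    bij \<rho> \<and> conjugate_linear \<rho> \<and>
    (\<forall>x y. \<rho> (x * y) = \<rho> x * \<rho> y) \<and> (\<forall>x. \<rho> (star x) = star (\<rho> x))"
  by (simp add: star_isomorphism_iff conjugate_linear_def conjugate_ops scaleC_conjugate_def
      star_conjugate_def bij_comp_left_iff[OF bij_Conj])

theorem theorem2p5:
  shows "((\<exists>\<rho> :: 'a :: cstar_algebra \<Rightarrow> 'a.
            bij \<rho> \<and> conjugate_linear \<rho> \<and>
            (\<forall>x y. \<rho> (x * y) = \<rho> x * \<rho> y) \<and> (\<forall>x. \<rho> (star x) = star (\<rho> x)))
          \<longleftrightarrow> (\<exists>f :: 'a \<Rightarrow> 'a opposite. star_isomorphism f)) \<and>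
         ((\<exists>f :: 'a \<Rightarrow> 'a opposite. star_isomorphism f)
          \<longleftrightarrow> (\<exists>g :: 'a \<Rightarrow> 'a conjugate. star_isomorphism g))"
proof -
  \<comment> \<open>Every map into the opposite algebra arises from some \<rho>, namely
    \<open>star\<close> after \<open>unopp\<close> after \<open>f\<close>, so quantifying over
    \<open>f\<close> amounts to quantifying over \<rho>.\<close>
  have "f = (\<lambda>x. Opp (star (star (unopp (f x)))))" for f :: "'a \<Rightarrow> 'a opposite"
    by (simp add: star_star)
  then have opp: "(\<exists>f :: 'a \<Rightarrow> 'a opposite. star_isomorphism f) \<longleftrightarrow>
      (\<exists>\<rho> :: 'a \<Rightarrow> 'a. star_isomorphism (\<lambda>x. Opp (star (\<rho> x))))"
    by metis
  have "g = (\<lambda>x. Conj (unconj (g x)))" for g :: "'a \<Rightarrow> 'a conjugate"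
    by simp
  then have conj: "(\<exists>g :: 'a \<Rightarrow> 'a conjugate. star_isomorphism g) \<longleftrightarrow>
      (\<exists>\<rho> :: 'a \<Rightarrow> 'a. star_isomorphism (\<lambda>x. Conj (\<rho> x)))"
    by metis
  \<comment> \<open>Both existence statements now unfold to the same condition on \<rho>, which is
    (i) itself.\<close>
  show ?thesis
    unfolding opp conj star_isomorphism_opposite_iff star_isomorphism_conjugate_iff by simp
qed

end
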